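(* Let $p$ be a prime, let $A\subseteq\mathbb{Z}_p^2$ be a $g$-Sidon set with $|A|=m$, and let $q=p^2s$ with $s$ a positive integer. Then there is a $g(s+1)$-Sidon set $A'\subseteq\mathbb{Z}_q$ with $|A'|=ms$.
   Context: For a subset $A$ of a commutative group, the representation function is $r(x)=\#\{(a_1,a_2): a_1,a_2\in A,\ a_1+a_2=x\}$ (ordered pairs). $A$ is a $g$-Sidon set if $r(x)\le g$ for all $x$. Here $\mathbb{Z}_n=\mathbb{Z}/n\mathbb{Z}$. *)

theory Defs
  imports "HOL-Algebra.Elementary_Groups" "HOL-Computational_Algebra.Primes"
begin

(* HOL-Algebra writes the operation of every group multiplicatively, so the sum of a and b
   in the additive groups considered here is their product in G. *)

definition reps :: "('a, 'b) monoid_scheme \<Rightarrow> 'a set \<Rightarrow> 'a \<Rightarrow> ('a \<times> 'a) set" where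
  "reps G A x = {(a, b). a \<in> A \<and> b \<in> A \<and> a \<otimes>\<^bsub>G\<^esub> b = x}"

definition rep_fun :: "('a, 'b) monoid_scheme \<Rightarrow> 'a set \<Rightarrow> 'a \<Rightarrow> nat" where
  "rep_fun G A x = card (reps G A x)"

(* Finiteness is required because card is 0 on infinite sets. *)
definition sidon_set :: "('a, 'b) monoid_scheme \<Rightarrow> nat \<Rightarrow> 'a set \<Rightarrow> bool" where
  "sidon_set G g A \<longleftrightarrow>
     A \<subseteq> carrier G \<and> (\<forall>x\<in>carrier G. finite (reps G A x) \<and> rep_fun G A x \<le> g)"

end

theory Submission
  imports Defs
begin

text \<open>
  Replace each \<open>(a, b) \<in> A\<close> by the \<open>s\<close> numbers \<open>a + p (c + s b)\<close> with \<open>0 \<le> c < s\<close>, i.e. insert a free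
  digit \<open>c\<close> into a mixed radix expansion. If two such numbers add up to \<open>x\<close> modulo \<open>p\<^sup>2 s\<close>, let
  \<open>x\<^sub>0\<close>, \<open>y\<close>, \<open>v\<close> be the digits of \<open>x\<close> and let \<open>d \<in> {0, 1}\<close> be the carry from the middle digit.
  The underlying pairs then add up to \<open>(x\<^sub>0, v - d)\<close>, which leaves at most \<open>g\<close> choices for them. If
  \<open>d = 0\<close> then \<open>c\<^sub>1 \<le> y\<close>, and if \<open>d = 1\<close> then \<open>y \<le> c\<^sub>1 < s\<close>, so there are at most
  \<open>g (y + 1) + g (s - y) = g (s + 1)\<close> representations of \<open>x\<close>.
\<close>

definition mixed_radix :: "int \<Rightarrow> int \<Rightarrow> (int \<times> int) \<times> int \<Rightarrow> int" where
  "mixed_radix p s = (\<lambda>((a, b), c). a + p * (c + s * b))"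

text \<open>Peels the lowest digit off both sides. \<open>u\<close> and \<open>w\<close> may exceed
  the range of a digit, so their quotients by \<open>P\<close> pass to the next digit as
  carries.\<close>

lemma split_last_digit:
  fixes P u t w k :: int
  assumes "P > 0" and "u + P * t = w + P * k"
  shows "u mod P = w mod P" and "u div P + t = w div P + k"
proof -
  show "u mod P = w mod P"
    using arg_cong[OF assms(2), of "\<lambda>z. z mod P"] by simp
  show "u div P + t = w div P + k"
    using arg_cong[OF assms(2), of "\<lambda>z. z div P"] \<open>P > 0\<close> by simp
qed

lemma carry_cases:
  fixes P u :: int
  assumes "0 \<le> u" and "u < 2 * P"
  shows "u div P = 0 \<or> u div P = 1"
proof (cases "u < P")
  case True
  then show ?thesis using assms by simp
next
  case False
  then have "u div P = 1" using assms by (intro int_div_pos_eq[where r = "u - P"]) auto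
  then show ?thesis ..
qed

text \<open>Reducing modulo \<open>p\<close> recovers \<open>a\<close>, reducing the quotient modulo
  \<open>s\<close> recovers \<open>c\<close>, and what remains is \<open>b\<close>, an arbitrary
  integer.\<close>

lemma inj_on_mixed_radix:
  assumes "p > 0" and "s > 0"
  shows "inj_on (mixed_radix p s) (({0..<p} \<times> UNIV) \<times> {0..<s})"
proof (rule inj_onI, clarsimp simp: mixed_radix_def)
  fix a b c a' b' c' :: int
  assume *: "a + p * (c + s * b) = a' + p * (c' + s * b')"
    and "0 \<le> a" "a < p" "0 \<le> a'" "a' < p" "0 \<le> c" "c < s" "0 \<le> c'" "c' < s"
  then have "a = a'" and **: "c + s * b = c' + s * b'"
    using split_last_digit[OF \<open>p > 0\<close> *] by auto
  then show "a = a' \<and> b = b' \<and> c = c'"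
    using split_last_digit[OF \<open>s > 0\<close> **] \<open>0 \<le> c\<close> \<open>c < s\<close> \<open>0 \<le> c'\<close> \<open>c' < s\<close> by auto
qed

text \<open>The largest value is \<open>(p - 1) + p * (s * p - 1)\<close>, which is
  \<open>p\<^sup>2 * s - 1\<close>.\<close>

lemma mixed_radix_mem:
  assumes "a \<in> {0..<p}" "b \<in> {0..<p}" "c \<in> {0..<s}"
  shows "mixed_radix p s ((a, b), c) \<in> {0..<p\<^sup>2 * s}"
proof -
  have "c + s * b \<ge> 0" using assms by auto
  have "s * b \<le> s * (p - 1)" using assms by (intro mult_left_mono) auto
  then have "c + s * b \<le> s * p - 1" using assms by (auto simp: algebra_simps)
  then have "p * (c + s * b) \<le> p * (s * p - 1)" using assms by (intro mult_left_mono) auto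
  then show ?thesis
    using assms \<open>c + s * b \<ge> 0\<close>
    by (auto simp: mixed_radix_def algebra_simps power2_eq_square)
qed

lemma mixed_radix_sum_cases:
  fixes p s x :: int
  assumes "p > 0" "s > 0"
    and a: "a1 \<in> {0..<p}" "a2 \<in> {0..<p}"
    and c: "c1 \<in> {0..<s}" "c2 \<in> {0..<s}"
    and sum: "(mixed_radix p s ((a1, b1), c1) + mixed_radix p s ((a2, b2), c2)) mod (p\<^sup>2 * s) = x"
  defines "y \<equiv> x div p mod s" and "v \<equiv> x div p div s"
  obtains "(a1 + a2) mod p = x mod p" "(b1 + b2) mod p = v mod p" "c1 \<in> {0..y}"
  | "(a1 + a2) mod p = x mod p" "(b1 + b2) mod p = (v - 1) mod p" "c1 \<in> {y..<s}"
proof -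
  define z where "z = mixed_radix p s ((a1, b1), c1) + mixed_radix p s ((a2, b2), c2)"
  \<comment> \<open>The wrap-around \<open>k\<close> reaches the top digit as \<open>p * k\<close>,
    so it vanishes modulo \<open>p\<close>.\<close>
  define k where "k = z div (p\<^sup>2 * s)"
  define e where "e = (a1 + a2) div p"
  define d where "d = (e + c1 + c2) div s"
  have "z = x + p\<^sup>2 * s * k"
    using sum mult_div_mod_eq[of "p\<^sup>2 * s" z] by (simp add: k_def z_def)
  then have "a1 + a2 + p * (c1 + c2 + s * (b1 + b2)) = x + p * (p * s * k)"
    by (simp add: z_def mixed_radix_def algebra_simps power2_eq_square)
  from split_last_digit[OF \<open>p > 0\<close> this]
  have x0: "(a1 + a2) mod p = x mod p"
    and "e + c1 + c2 + s * (b1 + b2) = x div p + s * (p * k)"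
    by (auto simp: e_def algebra_simps)
  from split_last_digit[OF \<open>s > 0\<close> this(2)]
  have "(e + c1 + c2) mod s = y" and "d + (b1 + b2) = v + p * k"
    by (auto simp: y_def v_def d_def)
  have e: "e = 0 \<or> e = 1"
    unfolding e_def using a by (intro carry_cases) auto
  \<comment> \<open>With the carry \<open>e\<close> from the lowest digit, the middle sum is at most
    1 + 2(s - 1) < 2s.\<close>
  have d: "d = 0 \<or> d = 1"
    unfolding d_def using c e by (intro carry_cases) auto
  have y: "e + c1 + c2 = y + s * d"
    using \<open>(e + c1 + c2) mod s = y\<close> mult_div_mod_eq[of s "e + c1 + c2"] by (simp add: d_def)
  have "b1 + b2 = v - d + p * k" using \<open>d + (b1 + b2) = v + p * k\<close> by simp
  then have "(b1 + b2) mod p = (v - d) mod p" by simp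
  \<comment> \<open>If \<open>d = 0\<close>, then \<open>c1\<close> is at most \<open>y\<close>
    because \<open>e\<close> and \<open>c2\<close> are nonnegative. If \<open>d = 1\<close>, then
    \<open>c1 = y + (s - c2) - e\<close> is at least \<open>y\<close> because \<open>s - c2\<close>
    is at least 1 and \<open>e\<close> at most 1.\<close>
  then show thesis using d that x0 y c e by auto
qed

theorem theorem5:
  fixes p g m s q :: nat and A :: "(int \<times> int) set"
  assumes "prime p"
    and "sidon_set (integer_mod_group p \<times>\<times> integer_mod_group p) g A"
    and "card A = m"
    and "s > 0"
    and "q = p\<^sup>2 * s"
  shows "\<exists>A'. sidon_set (integer_mod_group q) (g * (s + 1)) A' \<and> card A' = m * s"
proof -
  let ?G = "integer_mod_group p \<times>\<times> integer_mod_group p"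
  let ?f = "mixed_radix (int p) (int s)"
  define A' where "A' = ?f ` (A \<times> {0..<int s})"
  have p: "p > 0" using \<open>prime p\<close> prime_gt_0_nat by blast
  then have q: "q > 0" "int q = (int p)\<^sup>2 * int s" using assms by auto
  have A: "A \<subseteq> {0..<int p} \<times> {0..<int p}"
    using assms(2) p by (auto simp: sidon_set_def carrier_integer_mod_group DirProd_def)
  have "inj_on ?f (A \<times> {0..<int s})"
    by (rule inj_on_subset[OF inj_on_mixed_radix]) (use A p \<open>s > 0\<close> in auto)
  then have card: "card A' = m * s"
    using assms(3) by (simp add: A'_def card_image card_cartesian_product)
  have f_mem: "?f ((a, b), c) \<in> {0..<int q}" if "(a, b) \<in> A" "c \<in> {0..<int s}" for a b c
    unfolding q(2) using that A by (intro mixed_radix_mem) auto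
  then have "A' \<subseteq> {0..<int q}"
    by (force simp: A'_def)
  then have A'_carrier: "A' \<subseteq> carrier (integer_mod_group q)"
    using q by (simp add: carrier_integer_mod_group)
  have "finite (reps (integer_mod_group q) A' x) \<and>
        rep_fun (integer_mod_group q) A' x \<le> g * (s + 1)" for x
  proof -
    define y v where "y = x div int p mod int s" and "v = x div int p div int s"
    define R where "R d = reps ?G A (x mod int p, (v - d) mod int p)" for d
    define S where "S = R 0 \<times> {0..y} \<union> R 1 \<times> {y..<int s}"
    \<comment> \<open>\<open>c2\<close> need not be recorded: subtracting the first summand from
      \<open>x\<close> modulo \<open>q\<close> gives the second.\<close>
    define h where "h = (\<lambda>((u1, u2 :: int \<times> int), c). (?f (u1, c), (x - ?f (u1, c)) mod int q))"
    \<comment> \<open>Both coordinates of the target are reduced modulo \<open>p\<close>, so it lies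
      in the carrier, where the Sidon bound applies.\<close>
    have R: "finite (R d)" "card (R d) \<le> g" for d
      using assms(2) p
      by (auto simp: R_def sidon_set_def rep_fun_def carrier_integer_mod_group DirProd_def)
    have y: "0 \<le> y" "y < int s" using \<open>s > 0\<close> by (auto simp: y_def)
    have "finite S" using R by (simp add: S_def)
    have "reps (integer_mod_group q) A' x \<subseteq> h ` S"
    proof
      fix z assume "z \<in> reps (integer_mod_group q) A' x"
      then obtain a1 b1 c1 a2 b2 c2 where
        z: "z = (?f ((a1, b1), c1), ?f ((a2, b2), c2))"
        and mem: "(a1, b1) \<in> A" "(a2, b2) \<in> A" "c1 \<in> {0..<int s}" "c2 \<in> {0..<int s}"
        and sum: "(?f ((a1, b1), c1) + ?f ((a2, b2), c2)) mod int q = x"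
        by (auto simp: reps_def A'_def)
      have "?f ((a2, b2), c2) = (x - ?f ((a1, b1), c1)) mod int q"
        unfolding sum[symmetric] using f_mem[OF mem(2,4)] by (simp add: mod_diff_left_eq)
      then have hz: "z = h (((a1, b1), (a2, b2)), c1)" by (simp add: h_def z)
      have a: "a1 \<in> {0..<int p}" "a2 \<in> {0..<int p}" using mem A by auto
      have "(((a1, b1), (a2, b2)), c1) \<in> S"
        by (rule mixed_radix_sum_cases[OF _ _ a mem(3,4) sum[unfolded q(2)]])
           (use p \<open>s > 0\<close> mem in
             \<open>auto simp: S_def R_def reps_def y_def v_def DirProd_def\<close>)
      then show "z \<in> h ` S" using hz by blast
    qed
    moreover have "card S \<le> g * (s + 1)"
    proof -
      have "card S \<le> card (R 0) * nat (y + 1) + card (R 1) * nat (int s - y)"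
        unfolding S_def by (rule order.trans[OF card_Un_le]) (simp add: card_cartesian_product)
      also have "\<dots> \<le> g * nat (y + 1) + g * nat (int s - y)"
        using R by (intro add_mono mult_right_mono) auto
      also have "\<dots> = g * (nat (y + 1) + nat (int s - y))"
        by (rule distrib_left[symmetric])
      \<comment> \<open>The value \<open>y\<close> lies in both ranges of \<open>c1\<close>, hence
        \<open>s + 1\<close> instead of \<open>s\<close>.\<close>
      also have "nat (y + 1) + nat (int s - y) = s + 1"
        using y by linarith
      finally show ?thesis .
    qed
    ultimately show ?thesis
      using \<open>finite S\<close> unfolding rep_fun_def
      by (meson finite_surj surj_card_le order.trans)
  qed
  then show ?thesis
    using A'_carrier card unfolding sidon_set_def by blast
qed

end
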